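(* Let $V$ be a real vector space with an (Archimedean) order unit $e$, endowed with the topology defined by the norm $\|x\|_e = \inf\{\lambda \in \mathbb{R} \mid -\lambda e \leq x \leq \lambda e\}$. Then, a function $f : V \to \mathbb{R}$ is monotone, additively homogeneous, and positively homogeneous if, and only if, $$f(x) = \min_{y \in V} \; \max_{p \in \Delta_y} \; \langle p, x\rangle \quad \text{for all } x \in V,$$ where $$\Delta_y := \{ p \in V^* \mid \langle p,y\rangle \leq f(y),\ \langle p,e\rangle = 1,\ \langle p,x\rangle \geq 0 \ \ \forall x \in V,\ x \geq 0 \} .$$ Moreover, the value of the latter minimax expression does not change if the minimum is restricted to those $y \in V$ such that $f(y) = 0$, or if the maximum is restricted to the points $p \in \overline{\operatorname{ext} \Delta_y}$.
   Context: A vector space with an order unit is a real vector space $V$ with an order relation $\leq$ such that $x \leq y$ implies $x+z \leq y+z$ for all $z \in V$ and $\lambda x \leq \lambda y$ for all $\lambda \geq 0$, together with a vector $e \in V$ such that: for every $x \in V$ there is a scalar $\lambda > 0$ with $x \leq \lambda e$ (order unit); and for every $x \in V$, if $\lambda e + x \geq 0$ for all $\lambda > 0$ then $x \geq 0$ (Archimedean). $V^*$ is the space of all linear forms on $V$, and $\langle\cdot,\cdot\rangle$ is the duality product. A function $f : V \to \mathbb{R}$ is monotone if $x \leq y$ implies $f(x) \leq f(y)$; additively homogeneous if $f(\lambda e + x) = \lambda + f(x)$ for all $\lambda \in \mathbb{R}$, $x \in V$; positively homogeneous if $f(\lambda x) = \lambda f(x)$ for all $\lambda \geq 0$, $x \in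 V$. $\operatorname{ext}\Delta_y$ is the set of extreme points of $\Delta_y$, and the bar denotes closure in the weak* topology (pointwise convergence on $V$). Writing $\min$ and $\max$ means that the extrema are attained. *)

theory Defs
  imports "HOL-Analysis.Analysis" "HOL-Library.Function_Algebras"
begin

text \<open>
  The ordered vector space \<open>V\<close> is a type of class \<^class>\<open>ordered_real_vector\<close>, and \<open>V\<^sup>*\<close> is
  the set \<open>{p. linear p}\<close> of all linear forms \<open>p :: 'a \<Rightarrow> real\<close>.  Its vector space operations are
  the pointwise ones; the following instance makes \<^const>\<open>extreme_point_of\<close> applicable to
  subsets of \<open>V\<^sup>*\<close>.
\<close>

instantiation "fun" :: (type, real_vector) real_vector
begin

definition scaleR_fun_def: "scaleR r p = (\<lambda>x. r *\<^sub>R p x)"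

instance
  by standard (simp_all add: scaleR_fun_def plus_fun_def fun_eq_iff algebra_simps)

end

definition order_unit :: "'a::ordered_real_vector \<Rightarrow> bool" where
  "order_unit e \<longleftrightarrow> (\<forall>x. \<exists>l>0. x \<le> l *\<^sub>R e)"

definition archimedean_unit :: "'a::ordered_real_vector \<Rightarrow> bool" where
  "archimedean_unit e \<longleftrightarrow> (\<forall>x. (\<forall>l>0. 0 \<le> l *\<^sub>R e + x) \<longrightarrow> 0 \<le> x)"

definition additively_homogeneous :: "'a::real_vector \<Rightarrow> ('a \<Rightarrow> real) \<Rightarrow> bool" where
  "additively_homogeneous e f \<longleftrightarrow> (\<forall>l x. f (l *\<^sub>R e + x) = l + f x)"

definition positively_homogeneous :: "('a::real_vector \<Rightarrow> real) \<Rightarrow> bool" where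
  "positively_homogeneous f \<longleftrightarrow> (\<forall>l\<ge>0. \<forall>x. f (l *\<^sub>R x) = l * f x)"

definition Delta :: "'a::ordered_real_vector \<Rightarrow> ('a \<Rightarrow> real) \<Rightarrow> 'a \<Rightarrow> ('a \<Rightarrow> real) set" where
  "Delta e f y = {p. linear p \<and> p y \<le> f y \<and> p e = 1 \<and> (\<forall>x. 0 \<le> x \<longrightarrow> 0 \<le> p x)}"

text \<open>
  The library topology on \<open>'a \<Rightarrow> real\<close> is the product topology, that is, the topology of pointwise
  convergence; its restriction to the linear forms is the weak* topology.
\<close>

definition weak_star_topology :: "('a::real_vector \<Rightarrow> real) topology" where
  "weak_star_topology = top_of_set {p. linear p}"

definition ext :: "'a::real_vector set \<Rightarrow> 'a set" where
  "ext S = {p. p extreme_point_of S}"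

text \<open>
  The assertions below include that the extremum is attained; in particular the index set is
  nonempty.
\<close>

definition is_max :: "real \<Rightarrow> 'b set \<Rightarrow> ('b \<Rightarrow> real) \<Rightarrow> bool" where
  "is_max m S g \<longleftrightarrow> (\<exists>s\<in>S. g s = m) \<and> (\<forall>s\<in>S. g s \<le> m)"

definition is_min :: "real \<Rightarrow> 'b set \<Rightarrow> ('b \<Rightarrow> real) \<Rightarrow> bool" where
  "is_min m S g \<longleftrightarrow> (\<exists>s\<in>S. g s = m) \<and> (\<forall>s\<in>S. m \<le> g s)"

text \<open>
  \<open>is_minimax v Y P x\<close> says that \<open>min\<^bsub>y\<in>Y\<^esub> max\<^bsub>p\<in>P y\<^esub> p x\<close> is well defined, with the minimum and
  all inner maxima attained, and equal to \<open>v\<close>; \<open>M y\<close> is the value of the inner maximum.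
\<close>

definition is_minimax ::
    "real \<Rightarrow> 'a set \<Rightarrow> ('a \<Rightarrow> ('a \<Rightarrow> real) set) \<Rightarrow> 'a \<Rightarrow> bool" where
  "is_minimax v Y P x \<longleftrightarrow>
     (\<exists>M. (\<forall>y\<in>Y. is_max (M y) (P y) (\<lambda>p. p x)) \<and> is_min v Y M)"

end

theory Submission
  imports Defs
begin

text \<open>
  Call a positive linear form \<open>p\<close> with \<open>p e = 1\<close> a state, so that \<open>Delta e f y\<close> is the set of
  states with \<open>p y \<le> f y\<close>.  Every functional of the form \<open>min\<^sub>y max\<^sub>p p x\<close> with states \<open>p\<close> is
  monotone and additively and positively homogeneous, because evaluations at states are
  (\<open>is_minimax_mono_homogeneous\<close>).

  Conversely, let \<open>f\<close> have these three properties.  For \<open>y = x\<close> every \<open>p\<close> in \<open>Delta e f y\<close>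
  satisfies \<open>p x \<le> f x\<close>, so it remains to find, for any \<open>x\<close> and \<open>y\<close>, a state with \<open>p y \<le> f y\<close>
  and \<open>f x \<le> p x\<close> (\<open>Delta_separates\<close>).  States are the linear minorants of the sublinear gauge
  \<open>z \<mapsto> inf {l. z \<le> l e}\<close>.  An inequality \<open>c \<le> p v\<close> is imposed on the linear minorants of a
  sublinear \<open>q\<close> by passing to the smaller functional \<open>z \<mapsto> inf\<^sub>t (q (z + t v) - t c)\<close>, \<open>t \<ge> 0\<close>,
  which is again finite and sublinear when \<open>c \<le> q v\<close>.  The two inequalities wanted are
  compatible by the properties of \<open>f\<close>, and a Hahn--Banach theorem
  (\<open>sublinear_dominates_linear\<close>) yields the state.

  The sets \<open>Delta e f y\<close> are convex and, by Tychonoff's theorem, compact for pointwise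
  convergence.  As in the proof of the Krein--Milman theorem, every evaluation attains its maximum
  over such a set at an extreme point (\<open>eval_max_at_extreme_point\<close>).  So the inner maxima are
  attained, and they do not change on the closure of the extreme points.  Translating \<open>y\<close> along
  \<open>e\<close> to a zero of \<open>f\<close> does not change \<open>Delta e f y\<close>, which accounts for the restricted minimum.
\<close>

section \<open>Sublinear functionals and a Hahn--Banach theorem\<close>

definition sublinear :: "('a::real_vector \<Rightarrow> real) \<Rightarrow> bool" where
  "sublinear q \<longleftrightarrow> (\<forall>x y. q (x + y) \<le> q x + q y) \<and> (\<forall>t\<ge>0. \<forall>x. q (t *\<^sub>R x) = t * q x)"

lemma sublinear_add: "sublinear q \<Longrightarrow> q (x + y) \<le> q x + q y"
  and sublinear_scale: "sublinear q \<Longrightarrow> t \<ge> 0 \<Longrightarrow> q (t *\<^sub>R x) = t * q x"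
  by (auto simp: sublinear_def)

lemma sublinear_zero: "sublinear q \<Longrightarrow> q 0 = 0"
  using sublinear_scale[of q 0 0] by simp

lemma sublinear_uminus: "sublinear q \<Longrightarrow> - q (- x) \<le> q x"
  using sublinear_add[of q x "- x"] sublinear_zero[of q] by simp

text \<open>
  An inequality suffices for homogeneity: the converse one follows by scaling back with
  \<open>inverse t\<close>, and \<open>t = 2\<close>, \<open>t = 1/2\<close> give \<open>q 0 = 0\<close>.
\<close>

lemma sublinearI:
  assumes add: "\<And>x y. q (x + y) \<le> q x + q y"
    and scale: "\<And>t x. t > 0 \<Longrightarrow> q (t *\<^sub>R x) \<le> t * q x"
  shows "sublinear q"
proof -
  have zero: "q 0 = 0"
    using scale[of 2 0] scale[of "1/2" 0] by simp
  have "q (t *\<^sub>R x) = t * q x" if "t > 0" for t x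
  proof (rule antisym)
    have "q x \<le> inverse t * q (t *\<^sub>R x)"
      using scale[of "inverse t" "t *\<^sub>R x"] that by simp
    then show "t * q x \<le> q (t *\<^sub>R x)"
      using that by (simp add: field_simps)
  qed (use scale that in blast)
  then show ?thesis
    unfolding sublinear_def using add zero by (metis less_eq_real_def mult_zero_left scaleR_zero_left)
qed

lemma linear_if_sublinear_odd:
  assumes q: "sublinear q" and odd: "\<And>x. q (- x) = - q x"
  shows "linear q"
proof (rule linearI)
  fix x y :: 'a and t :: real
  have "- q (x + y) \<le> - q x - q y"
    using sublinear_add[OF q, of "- x" "- y"] odd[of "x + y"] by (simp add: odd)
  with sublinear_add[OF q, of x y] show "q (x + y) = q x + q y" by simp
  show "q (t *\<^sub>R x) = t *\<^sub>R q x"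
  proof (cases "t \<ge> 0")
    case False
    then show ?thesis using sublinear_scale[OF q, of "- t" x] odd[of "t *\<^sub>R x"] by simp
  qed (simp add: sublinear_scale[OF q])
qed

text \<open>
  When \<open>c \<le> q v\<close>, this is the largest sublinear functional below \<open>q\<close> whose linear minorants all
  satisfy \<open>c \<le> p v\<close>: tilting imposes one linear inequality on the minorants.
\<close>

definition tilt :: "('a::real_vector \<Rightarrow> real) \<Rightarrow> 'a \<Rightarrow> real \<Rightarrow> 'a \<Rightarrow> real" where
  "tilt q v c z = (INF t\<in>{0..}. q (z + t *\<^sub>R v) - t * c)"

lemma tilt_ge:
  assumes "\<And>t. t \<ge> 0 \<Longrightarrow> a \<le> q (z + t *\<^sub>R v) - t * c"
  shows "a \<le> tilt q v c z"
  unfolding tilt_def using assms by (intro cINF_greatest) auto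

lemma tilt_le:
  assumes q: "sublinear q" and c: "c \<le> q v" and t: "t \<ge> 0"
  shows "tilt q v c z \<le> q (z + t *\<^sub>R v) - t * c"
proof -
  have "- q (- z) \<le> q (z + s *\<^sub>R v) - s * c" if "s \<ge> 0" for s
  proof -
    have "s * c \<le> q (s *\<^sub>R v)"
      using c that by (simp add: sublinear_scale[OF q] mult_left_mono)
    also have "\<dots> \<le> q (z + s *\<^sub>R v) + q (- z)"
      using sublinear_add[OF q, of "z + s *\<^sub>R v" "- z"] by simp
    finally show ?thesis by simp
  qed
  then have "bdd_below ((\<lambda>s. q (z + s *\<^sub>R v) - s * c) ` {0..})"
    by (intro bdd_belowI2) auto
  then show ?thesis
    unfolding tilt_def using t by (intro cINF_lower) auto
qed

lemma tilt_le_self: "sublinear q \<Longrightarrow> c \<le> q v \<Longrightarrow> tilt q v c z \<le> q z"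
  using tilt_le[of q c v 0 z] by simp

lemma le_cINF_add_cINF:
  fixes g :: "'i \<Rightarrow> real" and h :: "'j \<Rightarrow> real"
  assumes "I \<noteq> {}" "J \<noteq> {}" and le: "\<And>i j. i \<in> I \<Longrightarrow> j \<in> J \<Longrightarrow> m \<le> g i + h j"
  shows "m \<le> (INF i\<in>I. g i) + (INF j\<in>J. h j)"
proof -
  have "m - h j \<le> (INF i\<in>I. g i)" if "j \<in> J" for j
    using assms(1) by (rule cINF_greatest) (use le that in fastforce)
  then have "m - (INF i\<in>I. g i) \<le> (INF j\<in>J. h j)"
    using assms(2) by (intro cINF_greatest) (auto simp: algebra_simps)
  then show ?thesis by simp
qed

lemma le_mult_cINF:
  fixes g :: "'i \<Rightarrow> real"
  assumes "I \<noteq> {}" "t > 0" and le: "\<And>i. i \<in> I \<Longrightarrow> m \<le> t * g i"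
  shows "m \<le> t * (INF i\<in>I. g i)"
proof -
  have "m / t \<le> (INF i\<in>I. g i)"
    using assms by (intro cINF_greatest) (auto simp: field_simps)
  then show ?thesis using assms(2) by (simp add: field_simps)
qed

lemma sublinear_tilt:
  assumes q: "sublinear q" and c: "c \<le> q v"
  shows "sublinear (tilt q v c)"
proof (rule sublinearI)
  fix x y :: 'a
  show "tilt q v c (x + y) \<le> tilt q v c x + tilt q v c y"
    unfolding tilt_def[of q v c x] tilt_def[of q v c y]
  proof (rule le_cINF_add_cINF)
    fix s t :: real assume st: "s \<in> {0..}" "t \<in> {0..}"
    have "tilt q v c (x + y) \<le> q ((x + y) + (s + t) *\<^sub>R v) - (s + t) * c"
      using tilt_le[OF q c] st by simp
    also have "(x + y) + (s + t) *\<^sub>R v = (x + s *\<^sub>R v) + (y + t *\<^sub>R v)"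
      by (simp add: algebra_simps)
    also have "q \<dots> \<le> q (x + s *\<^sub>R v) + q (y + t *\<^sub>R v)"
      by (rule sublinear_add[OF q])
    finally show "tilt q v c (x + y) \<le> q (x + s *\<^sub>R v) - s * c + (q (y + t *\<^sub>R v) - t * c)"
      by (simp add: algebra_simps)
  qed auto
next
  fix a :: real and x :: 'a assume a: "a > 0"
  show "tilt q v c (a *\<^sub>R x) \<le> a * tilt q v c x"
    unfolding tilt_def[of q v c x]
  proof (rule le_mult_cINF)
    fix t :: real assume t: "t \<in> {0..}"
    have "tilt q v c (a *\<^sub>R x) \<le> q (a *\<^sub>R x + (a * t) *\<^sub>R v) - (a * t) * c"
      using a t by (intro tilt_le[OF q c]) simp
    also have "a *\<^sub>R x + (a * t) *\<^sub>R v = a *\<^sub>R (x + t *\<^sub>R v)"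
      by (simp add: algebra_simps)
    also have "q \<dots> = a * q (x + t *\<^sub>R v)"
      using a by (simp add: sublinear_scale[OF q])
    finally show "tilt q v c (a *\<^sub>R x) \<le> a * (q (x + t *\<^sub>R v) - t * c)"
      by (simp add: algebra_simps)
  qed (use a in auto)
qed

text \<open>
  Evaluate the minorant at \<open>- v\<close>, where the term \<open>t = 1\<close> of the infimum is \<open>- c\<close>.
\<close>

lemma linear_le_tilt:
  assumes q: "sublinear q" and c: "c \<le> q v"
    and p: "linear p" "\<And>z. p z \<le> tilt q v c z"
  shows "c \<le> p v"
proof -
  have "- p v \<le> tilt q v c (- v)"
    using p(2)[of "- v"] linear_neg[OF p(1)] by simp
  also have "\<dots> \<le> - c"
    using tilt_le[OF q c, of 1 "- v"] sublinear_zero[OF q] by simp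
  finally show ?thesis by simp
qed

text \<open>
  The infimum is finite because \<open>- q (- z)\<close> bounds it below.  It is subadditive because, in a
  chain, the smaller of two functionals \<open>r\<close>, \<open>s\<close> serves both terms of \<open>r x + s y\<close>.
\<close>

lemma sublinear_INF_chain:
  assumes ne: "C \<noteq> {}"
    and sub: "\<And>r. r \<in> C \<Longrightarrow> sublinear r \<and> (\<forall>z. r z \<le> q z)"
    and chain: "\<And>r s. r \<in> C \<Longrightarrow> s \<in> C \<Longrightarrow> (\<forall>z. r z \<le> s z) \<or> (\<forall>z. s z \<le> r z)"
  shows "sublinear (\<lambda>z. INF r\<in>C. r z)" and "r \<in> C \<Longrightarrow> (INF r\<in>C. r z) \<le> r z"
proof -
  have lower: "(INF r\<in>C. r z) \<le> r z" if "r \<in> C" for r z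
  proof (rule cINF_lower)
    have "- q (- z) \<le> s z" if "s \<in> C" for s
      using sub[OF that] sublinear_uminus[of s z] by (meson neg_le_iff_le order_trans)
    then show "bdd_below ((\<lambda>r. r z) ` C)" by (intro bdd_belowI2)
  qed fact
  then show "r \<in> C \<Longrightarrow> (INF r\<in>C. r z) \<le> r z" .
  show "sublinear (\<lambda>z. INF r\<in>C. r z)"
  proof (rule sublinearI)
    fix x y
    show "(INF r\<in>C. r (x + y)) \<le> (INF r\<in>C. r x) + (INF r\<in>C. r y)"
    proof (rule le_cINF_add_cINF[OF ne ne])
      fix r s assume rs: "r \<in> C" "s \<in> C"
      then obtain u where u: "u \<in> C" "u x \<le> r x" "u y \<le> s y"
        using chain[OF rs] by blast
      have "(INF r\<in>C. r (x + y)) \<le> u (x + y)" using lower u by blast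
      also have "\<dots> \<le> u x + u y" using sub u sublinear_add by blast
      finally show "(INF r\<in>C. r (x + y)) \<le> r x + s y" using u by simp
    qed
  next
    fix t :: real and x assume t: "t > 0"
    show "(INF r\<in>C. r (t *\<^sub>R x)) \<le> t * (INF r\<in>C. r x)"
    proof (rule le_mult_cINF[OF ne t])
      fix r assume "r \<in> C"
      then show "(INF r\<in>C. r (t *\<^sub>R x)) \<le> t * r x"
        using lower[of r "t *\<^sub>R x"] sub[of r] t by (simp add: sublinear_scale)
    qed
  qed
qed

text \<open>
  This is the Hahn--Banach theorem without a prescribed subspace; further inequalities on \<open>p\<close> can
  be imposed by tilting \<open>q\<close> beforehand.  A minimal sublinear functional \<open>m\<close> below \<open>q\<close> exists by Zorn's lemma, and it is linear: its tilt
  by \<open>(v, m v)\<close> lies below \<open>m\<close>, hence equals \<open>m\<close>, and this forces \<open>m (- v) = - m v\<close>.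
\<close>

theorem sublinear_dominates_linear:
  assumes q: "sublinear q"
  obtains p where "linear p" "\<And>z. p z \<le> q z"
proof -
  define A where "A = {r. sublinear r \<and> (\<forall>z. r z \<le> q z)}"
  define P :: "('a \<Rightarrow> real) \<Rightarrow> ('a \<Rightarrow> real) \<Rightarrow> bool" where "P r s \<longleftrightarrow> (\<forall>z. s z \<le> r z)" for r s
  have "\<exists>m\<in>A. \<forall>r\<in>A. P m r \<longrightarrow> r = m"
  proof (rule predicate_Zorn)
    show "partial_order_on A (relation_of P A)"
      by (rule partial_order_on_relation_ofI) (auto simp: P_def fun_eq_iff intro: order_trans antisym)
    fix C assume C: "C \<in> Chains (relation_of P A)"
    show "\<exists>u\<in>A. \<forall>r\<in>C. P r u"
    proof (cases "C = {}")
      case True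
      then show ?thesis using q by (auto simp: A_def)
    next
      case False
      have sub: "\<And>r. r \<in> C \<Longrightarrow> sublinear r \<and> (\<forall>z. r z \<le> q z)"
        using Chains_relation_of[OF C] by (auto simp: A_def)
      have chain: "\<And>r s. r \<in> C \<Longrightarrow> s \<in> C \<Longrightarrow> (\<forall>z. r z \<le> s z) \<or> (\<forall>z. s z \<le> r z)"
        using C by (auto simp: Chains_def relation_of_def P_def)
      note inf = sublinear_INF_chain[OF False sub chain]
      obtain r0 where "r0 \<in> C" using False by blast
      then have "(INF r\<in>C. r z) \<le> q z" for z
        using order_trans[OF inf(2)[of r0 z]] sub by blast
      with inf(1) have "(\<lambda>z. INF r\<in>C. r z) \<in> A" unfolding A_def by blast
      moreover have "\<forall>r\<in>C. P r (\<lambda>z. INF r\<in>C. r z)"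
        unfolding P_def by (intro ballI allI inf(2))
      ultimately show ?thesis by blast
    qed
  qed
  then obtain m where mA: "m \<in> A" and mmin: "\<And>r. r \<in> A \<Longrightarrow> P m r \<Longrightarrow> r = m" by blast
  then have m: "sublinear m" "\<And>z. m z \<le> q z" by (simp_all add: A_def)
  have min: "r = m" if "sublinear r" "\<And>z. r z \<le> m z" for r
    using that order_trans[OF that(2) m(2)] by (intro mmin) (simp_all add: A_def P_def)
  have "m (- v) = - m v" for v
  proof (rule antisym)
    have "tilt m v (m v) = m"
      using m by (intro min sublinear_tilt tilt_le_self) auto
    then show "m (- v) \<le> - m v"
      using tilt_le[OF m(1), of "m v" v 1 "- v"] sublinear_zero[OF m(1)] by simp
    show "- m v \<le> m (- v)"
      using sublinear_uminus[OF m(1), of "- v"] by simp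
  qed
  then have "linear m" using m linear_if_sublinear_odd by blast
  with m that show thesis by blast
qed

section \<open>States of an ordered space with an order unit\<close>

text \<open>
  For an order unit \<open>e \<noteq> 0\<close>, the linear minorants of this gauge are exactly the states, that is,
  the positive linear forms \<open>p\<close> with \<open>p e = 1\<close>.
\<close>

definition unit_gauge :: "'a::ordered_real_vector \<Rightarrow> 'a \<Rightarrow> real" where
  "unit_gauge e z = Inf {l. z \<le> l *\<^sub>R e}"

context
  fixes e :: "'a::ordered_real_vector"
  assumes unit: "order_unit e" and nz: "e \<noteq> 0"
begin

lemma order_unit_nonneg: "0 \<le> e"
proof -
  obtain l where "l > 0" "0 \<le> l *\<^sub>R e" using unit unfolding order_unit_def by blast
  then show ?thesis by (simp add: zero_le_scaleR_iff)
qed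

lemma order_unit_le_scaleR_iff: "a *\<^sub>R e \<le> b *\<^sub>R e \<longleftrightarrow> a \<le> b"
proof
  assume "a *\<^sub>R e \<le> b *\<^sub>R e"
  then have "0 \<le> (b - a) *\<^sub>R e" by (simp add: scaleR_left_diff_distrib)
  then show "a \<le> b" using order_unit_nonneg nz by (auto simp: zero_le_scaleR_iff)
qed (rule scaleR_right_mono[OF _ order_unit_nonneg])

text \<open>
  The set of admissible \<open>l\<close> is bounded below: \<open>- b e \<le> z \<le> s e\<close> implies \<open>- b \<le> s\<close>, as \<open>e \<noteq> 0\<close>.
\<close>

lemma unit_gauge_le: "z \<le> l *\<^sub>R e \<Longrightarrow> unit_gauge e z \<le> l"
proof -
  assume z: "z \<le> l *\<^sub>R e"
  obtain b where b: "- z \<le> b *\<^sub>R e" using unit unfolding order_unit_def by blast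
  have "- b \<le> s" if "z \<le> s *\<^sub>R e" for s
  proof -
    have "(- b) *\<^sub>R e \<le> z" using b by (simp add: minus_le_iff)
    then show ?thesis using that order_unit_le_scaleR_iff order_trans by blast
  qed
  then show ?thesis
    unfolding unit_gauge_def using z by (intro cInf_lower bdd_belowI[of _ "- b"]) auto
qed

lemma unit_gauge_ge:
  assumes "\<And>l. z \<le> l *\<^sub>R e \<Longrightarrow> a \<le> l"
  shows "a \<le> unit_gauge e z"
  unfolding unit_gauge_def
  using unit assms unfolding order_unit_def by (intro cInf_greatest) auto

lemma sublinear_unit_gauge: "sublinear (unit_gauge e)"
proof (rule sublinearI)
  fix x y
  have "unit_gauge e (x + y) - l \<le> unit_gauge e x" if l: "y \<le> l *\<^sub>R e" for l
  proof (rule unit_gauge_ge)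
    fix s assume "x \<le> s *\<^sub>R e"
    with l have "x + y \<le> (s + l) *\<^sub>R e" by (simp add: scaleR_left_distrib add_mono)
    then show "unit_gauge e (x + y) - l \<le> s" using unit_gauge_le by fastforce
  qed
  then have "unit_gauge e (x + y) - unit_gauge e x \<le> unit_gauge e y"
    by (intro unit_gauge_ge) (simp add: algebra_simps)
  then show "unit_gauge e (x + y) \<le> unit_gauge e x + unit_gauge e y" by simp
next
  fix t :: real and x assume t: "t > 0"
  have "unit_gauge e (t *\<^sub>R x) / t \<le> unit_gauge e x"
  proof (rule unit_gauge_ge)
    fix l assume "x \<le> l *\<^sub>R e"
    then have "t *\<^sub>R x \<le> (t * l) *\<^sub>R e"
      using t scaleR_left_mono[of x "l *\<^sub>R e" t] by simp
    then show "unit_gauge e (t *\<^sub>R x) / t \<le> l"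
      using t unit_gauge_le by (simp add: field_simps)
  qed
  then show "unit_gauge e (t *\<^sub>R x) \<le> t * unit_gauge e x" using t by (simp add: field_simps)
qed

text \<open>
  The gauge is at most \<open>1\<close> at \<open>e\<close>, at most \<open>- 1\<close> at \<open>- e\<close>, and at most \<open>0\<close> at negative vectors.
\<close>

lemma linear_le_unit_gauge:
  assumes p: "linear p" "\<And>z. p z \<le> unit_gauge e z"
  shows "p e = 1" and "0 \<le> x \<Longrightarrow> 0 \<le> p x"
proof -
  have "p e \<le> 1" "- p e \<le> - 1"
    using p(2)[of e] p(2)[of "- e"] unit_gauge_le[of e 1] unit_gauge_le[of "- e" "- 1"]
      linear_neg[OF p(1), of e] by auto
  then show "p e = 1" by simp
  assume "0 \<le> x"
  then have "p (- x) \<le> 0" using p(2)[of "- x"] unit_gauge_le[of "- x" 0] by simp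
  then show "0 \<le> p x" using linear_neg[OF p(1), of x] by simp
qed

end

lemma Delta_le_scaleR:
  assumes "p \<in> Delta e f y" "x \<le> l *\<^sub>R e"
  shows "p x \<le> l"
proof -
  have lin: "linear p" and "0 \<le> p (l *\<^sub>R e - x)" "p e = 1"
    using assms by (auto simp: Delta_def)
  then show ?thesis by (simp add: linear_diff[OF lin] linear_scale[OF lin])
qed

text \<open>
  The constraints \<open>p y \<le> f y\<close> and \<open>f x \<le> p x\<close> are imposed on a state one after the other by
  tilting the gauge of \<open>e\<close>.  They are compatible because \<open>x \<le> l e + t y\<close> with \<open>t \<ge> 0\<close> implies
  \<open>f x \<le> l + t f y\<close>, by the three properties of \<open>f\<close>.
\<close>

lemma Delta_separates:
  fixes e :: "'a::ordered_real_vector"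
  assumes unit: "order_unit e"
    and f: "mono f" "additively_homogeneous e f" "positively_homogeneous f"
  obtains p where "p \<in> Delta e f y" "f x \<le> p x"
proof -
  have add: "f (l *\<^sub>R e + z) = l + f z" for l z
    using f(2) by (simp add: additively_homogeneous_def)
  have scale: "t \<ge> 0 \<Longrightarrow> f (t *\<^sub>R z) = t * f z" for t z
    using f(3) by (simp add: positively_homogeneous_def)
  have nz: "e \<noteq> 0" using add[of 1 0] by auto
  let ?q = "unit_gauge e" let ?r = "tilt ?q (- y) (- f y)"
  have bound: "f z - t * f y \<le> ?q (z - t *\<^sub>R y)" if t: "t \<ge> 0" for t z
  proof (rule unit_gauge_ge[OF unit nz])
    fix l assume "z - t *\<^sub>R y \<le> l *\<^sub>R e"
    then have "z \<le> l *\<^sub>R e + t *\<^sub>R y" by (simp add: diff_le_eq)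
    then have "f z \<le> f (l *\<^sub>R e + t *\<^sub>R y)" by (rule monoD[OF f(1)])
    then show "f z - t * f y \<le> l" using t by (simp add: add scale)
  qed
  note q = sublinear_unit_gauge[OF unit nz]
  have "f 0 = 0" using scale[of 0 0] by simp
  then have c: "- f y \<le> ?q (- y)" using bound[of 1 0] by simp
  note r = sublinear_tilt[OF q c]
  have d: "f x \<le> ?r x"
    by (rule tilt_ge) (use bound[of _ x] in \<open>simp add: algebra_simps\<close>)
  obtain p where p: "linear p" "\<And>z. p z \<le> tilt ?r x (f x) z"
    using sublinear_dominates_linear[OF sublinear_tilt[OF r d]] by blast
  have pr: "p z \<le> ?r z" for z
    using p(2) tilt_le_self[OF r d] order_trans by blast
  have pq: "p z \<le> ?q z" for z
    using pr tilt_le_self[OF q c] order_trans by blast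
  have "p y \<le> f y"
    using linear_le_tilt[OF q c p(1) pr] linear_neg[OF p(1)] by simp
  moreover have "f x \<le> p x" using linear_le_tilt[OF r d p] .
  moreover note linear_le_unit_gauge[OF unit nz p(1) pq]
  ultimately show thesis using that p(1) by (auto simp: Delta_def)
qed

section \<open>Pointwise compactness and extreme points\<close>

text \<open>
  By Tychonoff's theorem: \<open>S\<close> is a closed subset of a product of compact intervals.
\<close>

lemma compact_pointwise_bounded:
  fixes S :: "('a \<Rightarrow> real) set"
  assumes "closed S" and bd: "\<And>x. \<exists>c. \<forall>p\<in>S. \<bar>p x\<bar> \<le> c"
  shows "compact S"
proof -
  obtain c where c: "\<And>x p. p \<in> S \<Longrightarrow> \<bar>p x\<bar> \<le> c x" using bd by metis
  have "compact (PiE UNIV (\<lambda>x. {- c x..c x}))"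
    using compactin_PiE[of "\<lambda>_::'a. euclideanreal" UNIV "\<lambda>x. {- c x..c x}"]
    by (simp add: euclidean_product_topology)
  moreover have "S \<subseteq> PiE UNIV (\<lambda>x. {- c x..c x})"
    proof
    fix p assume "p \<in> S"
    then have "- c x \<le> p x \<and> p x \<le> c x" for x using c[of p x] by linarith
    then show "p \<in> PiE UNIV (\<lambda>x. {- c x..c x})" by (auto intro: PiE_I)
  qed
  ultimately show ?thesis
    using assms(1) by (metis compact_Int_closed inf.absorb_iff2)
qed

lemma continuous_on_eval: "continuous_on S (\<lambda>p::'a \<Rightarrow> real. p x)"
  by (rule continuous_on_subset[OF continuous_on_product_coordinates]) simp

lemma closed_eval_level:
  fixes K :: "('a \<Rightarrow> real) set"
  assumes "closed K"
  shows "closed {p \<in> K. p x = m}"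
proof -
  have "closed (K \<inter> {p. p x = m})"
    by (intro closed_Int assms closed_Collect_eq continuous_on_eval continuous_on_const)
  then show ?thesis by (simp add: Int_def)
qed

lemma closed_Delta: "closed (Delta e f y)"
  unfolding Delta_def linear_iff
  by (intro closed_Collect_conj closed_Collect_all closed_Collect_eq closed_Collect_le
      closed_Collect_imp continuous_intros continuous_on_eval) auto

text \<open>
  The order unit bounds every evaluation on the states, since \<open>- b e \<le> x \<le> a e\<close> implies
  \<open>- b \<le> p x \<le> a\<close>.
\<close>

lemma compact_Delta:
  assumes "order_unit e"
  shows "compact (Delta e f y)"
proof (rule compact_pointwise_bounded[OF closed_Delta])
  fix x
  obtain a b where ab: "x \<le> a *\<^sub>R e" "- x \<le> b *\<^sub>R e"
    using assms unfolding order_unit_def by blast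
  have "\<bar>p x\<bar> \<le> max a b" if p: "p \<in> Delta e f y" for p
  proof -
    have "linear p" using p by (simp add: Delta_def)
    then show ?thesis
      using Delta_le_scaleR[OF p ab(1)] Delta_le_scaleR[OF p ab(2)] by (simp add: linear_neg)
  qed
  then show "\<exists>c. \<forall>p\<in>Delta e f y. \<bar>p x\<bar> \<le> c" by blast
qed

lemma convex_Delta: "convex (Delta e f y)"
proof (rule convexI)
  fix p q :: "'a \<Rightarrow> real" and u v :: real
  assume pq: "p \<in> Delta e f y" "q \<in> Delta e f y" and uv: "u \<ge> 0" "v \<ge> 0" "u + v = 1"
  have eq: "u *\<^sub>R p + v *\<^sub>R q = (\<lambda>z. u * p z + v * q z)"
    by (simp add: fun_eq_iff scaleR_fun_def)
  have "linear (\<lambda>z. u * p z + v * q z)"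
    using pq by (auto simp: Delta_def linear_iff algebra_simps)
  moreover have "u * p y + v * q y \<le> f y"
    using pq uv by (intro convex_bound_le) (auto simp: Delta_def)
  ultimately show "u *\<^sub>R p + v *\<^sub>R q \<in> Delta e f y"
    unfolding eq using pq uv by (auto simp: Delta_def)
qed

text \<open>
  A convex combination, with positive weights, of two numbers bounded by \<open>m\<close> equals \<open>m\<close> only if
  both do.
\<close>

lemma face_of_eval_max:
  fixes K :: "('a \<Rightarrow> real) set"
  assumes K: "convex K" and le: "\<And>p. p \<in> K \<Longrightarrow> p x \<le> m"
  shows "{p \<in> K. p x = m} face_of K"
  unfolding face_of_def
proof (intro conjI ballI impI)
  show "convex {p \<in> K. p x = m}"
  proof (rule convexI)
    fix p q :: "'a \<Rightarrow> real" and u v :: real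
    assume *: "p \<in> {p \<in> K. p x = m}" "q \<in> {p \<in> K. p x = m}" "u \<ge> 0" "v \<ge> 0" "u + v = 1"
    then have "u *\<^sub>R p + v *\<^sub>R q \<in> K" using K by (auto intro: convexD)
    moreover have "u * m + v * m = m" using *(5) by (metis distrib_right mult_1)
    ultimately show "u *\<^sub>R p + v *\<^sub>R q \<in> {p \<in> K. p x = m}" using * by (simp add: scaleR_fun_def)
  qed
  fix a b p :: "'a \<Rightarrow> real"
  assume ab: "a \<in> K" "b \<in> K" and p: "p \<in> {p \<in> K. p x = m}" "p \<in> open_segment a b"
  obtain u where u: "0 < u" "u < 1" "p = (1 - u) *\<^sub>R a + u *\<^sub>R b"
    using p(2) by (auto simp: in_segment)
  have eq: "(1 - u) * (m - a x) + u * (m - b x) = 0"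
    using p(1) u(3) by (auto simp: scaleR_fun_def algebra_simps)
  have "(1 - u) * (m - a x) \<ge> 0" "u * (m - b x) \<ge> 0" using le ab u by auto
  with eq have "(1 - u) * (m - a x) = 0" "u * (m - b x) = 0" by linarith+
  then show "a \<in> {p \<in> K. p x = m}" "b \<in> {p \<in> K. p x = m}" using u ab by auto
qed auto

lemma compact_Inter_chain_nonempty:
  assumes K: "compact K" and ne: "C \<noteq> {}"
    and mem: "\<And>F. F \<in> C \<Longrightarrow> closed F \<and> F \<noteq> {} \<and> F \<subseteq> K"
    and chain: "\<And>F G. F \<in> C \<Longrightarrow> G \<in> C \<Longrightarrow> F \<subseteq> G \<or> G \<subseteq> F"
  shows "\<Inter>C \<noteq> {}"
proof -
  have "K \<inter> \<Inter>C \<noteq> {}"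
  proof (rule compact_imp_fip[OF K])
    fix D assume D: "finite D" "D \<subseteq> C"
    show "K \<inter> \<Inter>D \<noteq> {}"
    proof (cases "D = {}")
      case True
      then show ?thesis using ne mem by auto
    next
      case False
      obtain G where "G \<in> D" "\<And>F. F \<in> D \<Longrightarrow> F \<subseteq> G \<Longrightarrow> G = F"
        using finite_has_minimal[OF D(1) False] by metis
      then have "G \<subseteq> \<Inter>D" "G \<in> C" using chain D(2) by blast+
      then show ?thesis using mem by blast
    qed
  qed (use mem in blast)
  then show ?thesis by blast
qed

text \<open>
  This is the Krein--Milman argument: in a minimal closed nonempty face every evaluation is
  constant, since otherwise its maximizers would form a smaller one; and evaluations separate
  points, so the face is a single extreme point.
\<close>

lemma compact_convex_has_extreme_point:
  fixes K :: "('a \<Rightarrow> real) set"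
  assumes K: "compact K" "closed K" "convex K" "K \<noteq> {}"
  obtains p where "p extreme_point_of K"
proof -
  define A where "A = {F. F face_of K \<and> closed F \<and> F \<noteq> {}}"
  have sub: "F \<subseteq> K" if "F \<in> A" for F
    using that face_of_imp_subset by (auto simp: A_def)
  have "\<exists>M\<in>A. \<forall>F\<in>A. M \<supseteq> F \<longrightarrow> F = M"
  proof (rule predicate_Zorn)
    show "partial_order_on A (relation_of (\<supseteq>) A)"
      by (rule partial_order_on_relation_ofI) auto
    fix C assume C: "C \<in> Chains (relation_of (\<supseteq>) A)"
    note CA = Chains_relation_of[OF C]
    show "\<exists>U\<in>A. \<forall>F\<in>C. F \<supseteq> U"
    proof (cases "C = {}")
      case True
      then show ?thesis using K face_of_refl by (auto simp: A_def)
    next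
      case False
      have "\<Inter>C \<noteq> {}"
      proof (rule compact_Inter_chain_nonempty[OF K(1) False])
        show "F \<subseteq> G \<or> G \<subseteq> F" if "F \<in> C" "G \<in> C" for F G
          using C that by (auto simp: Chains_def relation_of_def)
      qed (use CA sub in \<open>auto simp: A_def\<close>)
      moreover have "\<Inter>C face_of K" "closed (\<Inter>C)"
        using CA False by (auto simp: A_def intro!: face_of_Inter)
      ultimately show ?thesis by (intro bexI[of _ "\<Inter>C"]) (auto simp: A_def)
    qed
  qed
  then obtain M where M: "M face_of K" "closed M" "M \<noteq> {}"
    and min: "\<And>F. F face_of K \<Longrightarrow> closed F \<Longrightarrow> F \<noteq> {} \<Longrightarrow> F \<subseteq> M \<Longrightarrow> F = M"
    by (auto simp: A_def)
  have "compact M"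
    using K(1) M(2) face_of_imp_subset[OF M(1)] by (metis compact_Int_closed inf.absorb_iff2)
  have const: "\<exists>m. \<forall>p\<in>M. p v = m" for v
  proof -
    obtain p0 where p0: "p0 \<in> M" "\<And>p. p \<in> M \<Longrightarrow> p v \<le> p0 v"
      using continuous_attains_sup[OF \<open>compact M\<close> M(3) continuous_on_eval] by blast
    let ?F = "{p \<in> M. p v = p0 v}"
    have "closed ?F" by (rule closed_eval_level[OF M(2)])
    moreover have "?F face_of K"
      by (rule face_of_trans[OF face_of_eval_max[OF face_of_imp_convex[OF M(1)] p0(2)] M(1)])
    ultimately have "?F = M" by (intro min) (use p0(1) in auto)
    then have "\<forall>p\<in>M. p v = p0 v" by blast
    then show ?thesis ..
  qed
  obtain p where "p \<in> M" using M(3) by blast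
  moreover have "q = p" if "q \<in> M" for q
  proof (rule HOL.ext)
    show "q v = p v" for v using const[of v] that \<open>p \<in> M\<close> by metis
  qed
  ultimately have "M = {p}" by blast
  then show thesis using M(1) face_of_singleton that by blast
qed

text \<open>
  The maximizers of an evaluation form a compact face, which has an extreme point; extreme points
  of a face are extreme in the whole set.
\<close>

lemma eval_max_at_extreme_point:
  fixes K :: "('a \<Rightarrow> real) set"
  assumes K: "compact K" "closed K" "convex K" "K \<noteq> {}"
  obtains p where "p extreme_point_of K" "\<And>q. q \<in> K \<Longrightarrow> q x \<le> p x"
proof -
  obtain p0 where p0: "p0 \<in> K" "\<And>p. p \<in> K \<Longrightarrow> p x \<le> p0 x"
    using continuous_attains_sup[OF K(1,4) continuous_on_eval] by blast
  let ?F = "{p \<in> K. p x = p0 x}"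
  have face: "?F face_of K" by (rule face_of_eval_max[OF K(3) p0(2)])
  have closed: "closed ?F" by (rule closed_eval_level[OF K(2)])
  have "compact ?F"
    using compact_Int_closed[OF K(1) closed] by (simp add: Int_def conj_commute)
  moreover have "convex ?F" using face face_of_imp_convex by blast
  ultimately obtain p where p: "p extreme_point_of ?F"
    using compact_convex_has_extreme_point closed p0(1) by (metis (mono_tags, lifting) empty_iff mem_Collect_eq)
  then have "p extreme_point_of K" "p x = p0 x"
    using extreme_point_of_face[OF face] by auto
  then show thesis using that p0(2) by simp
qed

section \<open>The minimax formula\<close>

lemma ext_Delta_subset_closure: "ext (Delta e f y) \<subseteq> weak_star_topology closure_of ext (Delta e f y)"
  unfolding weak_star_topology_def
  by (rule closure_of_subset) (auto simp: ext_def extreme_point_of_def Delta_def)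

lemma closure_ext_Delta_subset: "weak_star_topology closure_of ext (Delta e f y) \<subseteq> Delta e f y"
proof (rule closure_of_minimal)
  show "ext (Delta e f y) \<subseteq> Delta e f y" by (auto simp: ext_def extreme_point_of_def)
  show "closedin weak_star_topology (Delta e f y)"
    unfolding weak_star_topology_def
    by (rule closed_subset[OF _ closed_Delta]) (auto simp: Delta_def)
qed

text \<open>
  All three properties express inequalities \<open>f x' \<le> a * f x + b\<close> with \<open>a \<ge> 0\<close>, and a minimax of
  evaluations inherits such an inequality when every state satisfies it.  The equations follow by
  applying the inequality with \<open>- l\<close> instead of \<open>l\<close>, and with \<open>inverse t\<close> instead of \<open>t\<close>.
\<close>

lemma is_minimax_mono_homogeneous:
  assumes "\<And>x. is_minimax (f x) UNIV (Delta e f) x"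
  shows "mono f" "additively_homogeneous e f" "positively_homogeneous f"
proof -
  \<comment> \<open>at an optimal \<open>y\<close> for \<open>x\<close>, compare the values of a maximizer \<open>p\<close> for \<open>x'\<close>\<close>
  have transfer: "f x' \<le> a * f x + b"
    if le: "\<forall>y. \<forall>p\<in>Delta e f y. p x' \<le> a * p x + b" and a: "a \<ge> 0" for x x' a b
  proof -
    obtain M where M: "\<And>y. is_max (M y) (Delta e f y) (\<lambda>p. p x)" "is_min (f x) UNIV M"
      using assms[of x] unfolding is_minimax_def by blast
    obtain M' where M': "\<And>y. is_max (M' y) (Delta e f y) (\<lambda>p. p x')" "is_min (f x') UNIV M'"
      using assms[of x'] unfolding is_minimax_def by blast
    obtain y where y: "M y = f x" using M(2) by (auto simp: is_min_def)
    obtain p where p: "p \<in> Delta e f y" "p x' = M' y" using M'(1)[of y] by (auto simp: is_max_def)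
    have "f x' \<le> p x'" using M'(2) p by (simp add: is_min_def)
    also have "\<dots> \<le> a * p x + b" using le p by blast
    also have "\<dots> \<le> a * f x + b"
      using M(1)[of y] p y a by (auto simp: is_max_def mult_left_mono)
    finally show ?thesis .
  qed
  have lin: "linear p" "p e = 1" if "p \<in> Delta e f y" for p y
    using that by (auto simp: Delta_def)
  show "mono f"
  proof (rule monoI)
    fix x x' :: 'a assume "x \<le> x'"
    then have "p x \<le> 1 * p x' + 0" if "p \<in> Delta e f y" for p y
      using that linear_diff[OF lin(1)[OF that], of x' x] by (auto simp: Delta_def dest: spec[of _ "x' - x"])
    then have "f x \<le> 1 * f x' + 0" by (intro transfer) auto
    then show "f x \<le> f x'" by simp
  qed
  have add: "f (l *\<^sub>R e + x) \<le> l + f x" for l x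
  proof -
    have "p (l *\<^sub>R e + x) \<le> 1 * p x + l" if "p \<in> Delta e f y" for p y
      using lin(2)[OF that] by (simp add: linear_add[OF lin(1)[OF that]] linear_scale[OF lin(1)[OF that]])
    then have "f (l *\<^sub>R e + x) \<le> 1 * f x + l" by (intro transfer) auto
    then show ?thesis by simp
  qed
  show "additively_homogeneous e f"
    unfolding additively_homogeneous_def
  proof (intro allI antisym add)
    fix l x
    have "f x \<le> - l + f (l *\<^sub>R e + x)" using add[of "- l" "l *\<^sub>R e + x"] by simp
    then show "l + f x \<le> f (l *\<^sub>R e + x)" by simp
  qed
  have scale: "f (t *\<^sub>R x) \<le> t * f x" if "t \<ge> 0" for t x
  proof -
    have "p (t *\<^sub>R x) \<le> t * p x + 0" if "p \<in> Delta e f y" for p y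
      by (simp add: linear_scale[OF lin(1)[OF that]])
    then have "f (t *\<^sub>R x) \<le> t * f x + 0" using \<open>t \<ge> 0\<close> by (intro transfer) auto
    then show ?thesis by simp
  qed
  \<comment> \<open>\<open>t = 2\<close> gives \<open>0 \<le> f 0\<close> and \<open>t = 0\<close> gives \<open>f 0 \<le> 0\<close>\<close>
  have zero: "f 0 = 0"
    using scale[of 2 0] scale[of 0 0] by simp
  show "positively_homogeneous f"
    unfolding positively_homogeneous_def
  proof (intro allI impI)
    fix t :: real and x assume "t \<ge> 0"
    show "f (t *\<^sub>R x) = t * f x"
    proof (cases "t = 0")
      case False
      then have "f x \<le> inverse t * f (t *\<^sub>R x)"
        using scale[of "inverse t" "t *\<^sub>R x"] \<open>t \<ge> 0\<close> by simp
      then have "t * f x \<le> f (t *\<^sub>R x)" using \<open>t \<ge> 0\<close> False by (simp add: field_simps)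
      then show ?thesis using scale \<open>t \<ge> 0\<close> by (simp add: antisym)
    qed (simp add: zero)
  qed
qed

text \<open>
  Every inner maximum is at least \<open>f x\<close> by \<open>Delta_separates\<close>, and it is attained at an extreme
  point of \<open>Delta e f y\<close>, so it is the same for all sets \<open>S y\<close> between the extreme points and
  \<open>Delta e f y\<close>.  The outer minimum is attained at \<open>y = x - f x e\<close>, a zero of \<open>f\<close>: there the
  constraint \<open>p y \<le> f y\<close> reads \<open>p x \<le> f x\<close>.
\<close>

lemma is_minimax_Delta:
  fixes e :: "'a::ordered_real_vector"
  assumes unit: "order_unit e"
    and f: "mono f" "additively_homogeneous e f" "positively_homogeneous f"
    and Y: "{y. f y = 0} \<subseteq> Y"
    and S: "\<And>y. ext (Delta e f y) \<subseteq> S y" "\<And>y. S y \<subseteq> Delta e f y"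
  shows "is_minimax (f x) Y S x"
proof -
  have "\<exists>p. p extreme_point_of Delta e f y \<and> (\<forall>q\<in>Delta e f y. q x \<le> p x)" for y
  proof -
    have "Delta e f y \<noteq> {}" using Delta_separates[OF unit f] by blast
    from eval_max_at_extreme_point[OF compact_Delta[OF unit] closed_Delta convex_Delta this]
    show ?thesis by metis
  qed
  then obtain P where P: "\<And>y. P y extreme_point_of Delta e f y"
    "\<And>y q. q \<in> Delta e f y \<Longrightarrow> q x \<le> P y x" by metis
  have PS: "P y \<in> S y" for y using P(1)[of y] S(1) by (auto simp: ext_def)
  have PD: "P y \<in> Delta e f y" for y using PS S(2) by blast
  have le: "f x \<le> P y x" for y
    using Delta_separates[OF unit f, of y x] P(2) order_trans by metis
  let ?y = "(- f x) *\<^sub>R e + x"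
  have "f ?y = 0" using f(2)[unfolded additively_homogeneous_def, rule_format, of "- f x" x] by linarith
  moreover have "P ?y x \<le> f x"
  proof -
    have lin: "linear (P ?y)" and "P ?y ?y \<le> f ?y" "P ?y e = 1"
      using PD[of ?y] by (auto simp: Delta_def)
    then show ?thesis using \<open>f ?y = 0\<close> by (simp only: linear_add[OF lin] linear_scale[OF lin]) simp
  qed
  ultimately have "is_min (f x) Y (\<lambda>y. P y x)"
    using Y le by (auto simp: is_min_def intro!: bexI[of _ ?y] antisym)
  moreover have "is_max (P y x) (S y) (\<lambda>p. p x)" for y
    using PS P(2) S(2) unfolding is_max_def by blast
  ultimately show ?thesis unfolding is_minimax_def by (intro exI[of _ "\<lambda>y. P y x"]) simp
qed

theorem corollary3p11:
  fixes e :: "'a::ordered_real_vector" and f :: "'a \<Rightarrow> real"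
  assumes "order_unit e" and "archimedean_unit e"
  shows "((mono f \<and> additively_homogeneous e f \<and> positively_homogeneous f)
            \<longleftrightarrow> (\<forall>x. is_minimax (f x) UNIV (Delta e f) x))
       \<and> (mono f \<and> additively_homogeneous e f \<and> positively_homogeneous f
            \<longrightarrow> (\<forall>x. is_minimax (f x) {y. f y = 0} (Delta e f) x
                   \<and> is_minimax (f x) UNIV
                        (\<lambda>y. weak_star_topology closure_of ext (Delta e f y)) x
                   \<and> is_minimax (f x) {y. f y = 0}
                        (\<lambda>y. weak_star_topology closure_of ext (Delta e f y)) x))"
proof -
  have ext_subset: "ext (Delta e f y) \<subseteq> Delta e f y" for y
    by (auto simp: ext_def extreme_point_of_def)
  note minimax = is_minimax_Delta[OF assms(1)]
  show ?thesis
    using is_minimax_mono_homogeneous[of f e]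
    by (intro conjI iffI impI allI)
      (auto intro!: minimax ext_subset ext_Delta_subset_closure closure_ext_Delta_subset)
qed

end
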